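(* Let $p>3$ be a prime number such that for no non-negative integer $r$ does the congruence $-1\equiv 2^r \pmod p$ hold. Then for $n=p+2$ one has $\chi(G(n,3,2))\le n-2$, and for $n=p+1$ one has $\chi(G(n,3,2))\le n-1$.
   Context: For integers $n,r,s$, let $\mathcal{R}_n=\{0,1,\ldots,n-1\}$ and let $G(n,r,s)$ be the graph whose vertices are all $r$-element subsets of $\mathcal{R}_n$, two distinct vertices $u,v$ being joined by an edge if and only if $|u\cap v|=s$. The chromatic number $\chi(G)$ of a graph $G$ is the least number of colors needed to color its vertices so that the endpoints of every edge have different colors. *)

theory Defs
  imports "HOL-Number_Theory.Number_Theory"
begin

text \<open>A graph is a pair of its vertex set and its set of (undirected) edges; an edge is the
  two-element set of its endpoints.\<close>

type_synonym 'a graph = "'a set \<times> 'a set set"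

definition verts :: "'a graph \<Rightarrow> 'a set" where
  "verts = fst"

definition edges :: "'a graph \<Rightarrow> 'a set set" where
  "edges = snd"

definition proper_coloring :: "'a graph \<Rightarrow> nat \<Rightarrow> ('a \<Rightarrow> nat) \<Rightarrow> bool" where
  "proper_coloring G k c \<longleftrightarrow>
     (\<forall>v\<in>verts G. c v < k) \<and> (\<forall>u v. {u, v} \<in> edges G \<longrightarrow> c u \<noteq> c v)"

text \<open>The minimum is only meaningful if some proper coloring with finitely many colors exists;
  for the graphs considered here this is the lemma \<open>ex_proper_coloring_intersection_graph\<close> below.\<close>

definition chromatic_number :: "'a graph \<Rightarrow> nat" where
  "chromatic_number G = (LEAST k. \<exists>c. proper_coloring G k c)"

definition subsets_of_size :: "nat \<Rightarrow> nat \<Rightarrow> nat set set" where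
  "subsets_of_size n r = {A. A \<subseteq> {0..<n} \<and> card A = r}"

definition intersection_graph :: "nat \<Rightarrow> nat \<Rightarrow> nat \<Rightarrow> nat set graph" where
  "intersection_graph n r s =
     (subsets_of_size n r,
      {{u, v} | u v. u \<in> subsets_of_size n r \<and> v \<in> subsets_of_size n r \<and> u \<noteq> v
                     \<and> card (u \<inter> v) = s})"

lemma ex_proper_coloring_intersection_graph:
  "\<exists>k c. proper_coloring (intersection_graph n r s) k c"
proof -
  have "finite (subsets_of_size n r)"
    by (simp add: subsets_of_size_def)
  then obtain c :: "nat set \<Rightarrow> nat" and k where
      c: "c ` subsets_of_size n r = {i. i < k}" "inj_on c (subsets_of_size n r)"
    using finite_imp_inj_to_nat_seg by blast
  have "c v < k" if "v \<in> subsets_of_size n r" for v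
    using c(1) imageI[OF that, of c] by simp
  moreover have "c u \<noteq> c v" if uv: "{u, v} \<in> edges (intersection_graph n r s)" for u v
  proof -
    obtain x y where xy: "{u, v} = {x, y}" "x \<in> subsets_of_size n r" "y \<in> subsets_of_size n r"
        "x \<noteq> y"
      using uv unfolding edges_def intersection_graph_def snd_conv by blast
    have "c x \<noteq> c y"
      using xy(2-4) inj_onD[OF c(2)] by blast
    then show ?thesis
      using xy(1) unfolding doubleton_eq_iff by (elim disjE conjE) simp_all
  qed
  ultimately have "proper_coloring (intersection_graph n r s) k c"
    by (simp add: proper_coloring_def verts_def intersection_graph_def)
  then show ?thesis by blast
qed

end

theory Submission
  imports Defs
begin

text \<open>
  The \<open>p + 2\<close> points are read as the residues \<open>0, \<dots>, p - 1\<close> together with two points at infinity,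
  \<open>p\<close> and \<open>p + 1\<close>. A triple of residues is coloured by its sum modulo \<open>p\<close>; this is proper because
  two members of a triple and the sum determine the third. The idea is to colour a triple with
  points at infinity by the same rule, after each point at infinity has been replaced by one of the
  residues in the triple. In \<open>{\<infinity>, x, y}\<close> the substitute must be \<open>x\<close> or \<open>y\<close>: the sums
  \<open>2x + y\<close> and \<open>x + 2y\<close> are exactly those which no triple of distinct residues containing \<open>x\<close> and \<open>y\<close>
  attains. The two points at infinity must make opposite choices, and in \<open>{p, p + 1, x}\<close> both
  become \<open>x\<close>, which gives the colour \<open>3x\<close>.

  Let \<open>p\<close> choose \<open>x\<close> in \<open>{p, x, y}\<close> when a predicate \<open>P\<close> holds of the difference \<open>x - y\<close>. This is a
  well defined choice if exactly one of \<open>P t\<close> and \<open>P (-t)\<close> holds for each \<open>t\<close> prime to \<open>p\<close>. The only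
  clash left is between \<open>{\<infinity>, a, x}\<close> with substitute \<open>a\<close> and \<open>{\<infinity>, a, y}\<close> with substitute \<open>y\<close>: the
  colours agree when \<open>a + x = 2y\<close>, that is, \<open>x - a = 2(y - a)\<close>. If \<open>P\<close> is invariant under doubling,
  the two choices are then incompatible.

  So what is needed is a set of residues closed under doubling that contains exactly one of each pair
  \<open>t, -t\<close> of nonzero residues (lemma \<open>ex_doubling_orientation\<close>). It exists because \<open>-1\<close> is
  no power of \<open>2\<close>: then the orbits of \<open>t\<close> and \<open>-t\<close> under doubling are disjoint, and one of the two
  can be selected. This gives \<open>p\<close> colours on \<open>p + 2\<close> points, hence also on \<open>p + 1\<close> points.
  On \<open>p + 2\<close> points the colour classes are the members of the large set of Steiner triple systems due to Schreiber and
  Wilson.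
\<close>

section \<open>Choosing between a residue and its negative\<close>

definition doubling_orbit :: "nat \<Rightarrow> int \<Rightarrow> int set" where
  "doubling_orbit p t = range (\<lambda>k. (2 ^ k * t) mod int p)"

lemma finite_doubling_orbit:
  assumes "p > 0"
  shows "finite (doubling_orbit p t)"
proof (rule finite_subset)
  show "doubling_orbit p t \<subseteq> {0..<int p}"
    using assms by (auto simp: doubling_orbit_def)
qed simp

lemma doubling_orbit_nonempty: "doubling_orbit p t \<noteq> {}"
  by (simp add: doubling_orbit_def)

lemma doubling_orbit_cong:
  assumes "[s = t] (mod int p)"
  shows "doubling_orbit p s = doubling_orbit p t"
proof -
  have "(2 ^ k * s) mod int p = (2 ^ k * t) mod int p" for k
    using cong_scalar_left[OF assms, of "2 ^ k"] by (simp add: cong_def)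
  then show ?thesis by (simp add: doubling_orbit_def)
qed

lemma two_power_pred_prime_cong_1:
  assumes "prime p" and "p > 3"
  shows "[2 ^ (p - 1) = (1::int)] (mod int p)"
proof -
  have "\<not> p dvd 2"
    using assms(2) by (auto dest: dvd_imp_le)
  then have "[2 ^ (p - 1) = (1::nat)] (mod p)"
    using fermat_theorem[OF assms(1)] by blast
  then show ?thesis
    by (simp flip: cong_int_iff)
qed

text \<open>Doubling is invertible on residues, so the orbit of \<open>2 t\<close> gets back to \<open>t\<close>, after
  \<open>p - 2\<close> further steps.\<close>

lemma doubling_orbit_double:
  assumes "prime p" and "p > 3"
  shows "doubling_orbit p (2 * t) = doubling_orbit p t"
proof
  have "(2 ^ k * (2 * t)) mod int p \<in> doubling_orbit p t" for k
    unfolding doubling_orbit_def by (rule range_eqI[of _ _ "Suc k"]) (simp add: mult_ac)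
  then show "doubling_orbit p (2 * t) \<subseteq> doubling_orbit p t"
    by (auto simp: doubling_orbit_def)
next
  have "(2 ^ k * t) mod int p \<in> doubling_orbit p (2 * t)" for k
  proof -
    have "p - 1 = Suc (p - 2)" using assms(2) by simp
    then have "(2::int) ^ (p - 1) = 2 ^ (p - 2) * 2" by simp
    then have "2 ^ (k + (p - 2)) * (2 * t) = 2 ^ (p - 1) * (2 ^ k * t)"
      by (simp add: power_add mult_ac)
    moreover have "[2 ^ (p - 1) * (2 ^ k * t) = 1 * (2 ^ k * t)] (mod int p)"
      by (rule cong_scalar_right[OF two_power_pred_prime_cong_1[OF assms]])
    ultimately have "(2 ^ k * t) mod int p = (2 ^ (k + (p - 2)) * (2 * t)) mod int p"
      unfolding cong_def by (simp only: mult_1)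
    then show ?thesis
      unfolding doubling_orbit_def by (rule range_eqI)
  qed
  then show "doubling_orbit p t \<subseteq> doubling_orbit p (2 * t)"
    by (auto simp: doubling_orbit_def)
qed

text \<open>A common element of the two orbits gives \<open>2 ^ a = - (2 ^ b)\<close> modulo \<open>p\<close>; dividing by
  \<open>2 ^ b\<close>, whose inverse is \<open>2 ^ (b * (p - 2))\<close>, exhibits \<open>-1\<close> as a power of \<open>2\<close>.\<close>

lemma doubling_orbit_uminus_disjoint:
  assumes p: "prime p" "p > 3"
    and no_power: "\<not> (\<exists>r::nat. [-1 = 2 ^ r] (mod int p))"
    and t: "\<not> int p dvd t"
  shows "doubling_orbit p t \<inter> doubling_orbit p (- t) = {}"
proof (rule ccontr)
  assume "doubling_orbit p t \<inter> doubling_orbit p (- t) \<noteq> {}"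
  then obtain a b where "(2 ^ a * t) mod int p = (2 ^ b * (- t)) mod int p"
    unfolding doubling_orbit_def by blast
  then have "[2 ^ a * t = (- (2 ^ b)) * t] (mod int p)"
    by (simp add: cong_def)
  moreover have "coprime t (int p)"
    using prime_imp_coprime[of "int p" t] t p(1) by (simp add: coprime_commute)
  ultimately have ab: "[2 ^ a = - (2 ^ b)] (mod int p)"
    using cong_mult_rcancel by blast
  have "[(2 ^ (p - 1)) ^ b = (1::int) ^ b] (mod int p)"
    by (rule cong_pow[OF two_power_pred_prime_cong_1[OF p]])
  moreover have "((2::int) ^ (p - 1)) ^ b = 2 ^ b * 2 ^ (b * (p - 2))"
  proof -
    have "(p - 1) * b = b + b * (p - 2)"
      using p(2) by (simp add: algebra_simps diff_mult_distrib)
    then show ?thesis by (simp add: power_mult[symmetric] power_add[symmetric])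
  qed
  ultimately have inverse: "[2 ^ b * 2 ^ (b * (p - 2)) = (1::int)] (mod int p)"
    by simp
  have "[2 ^ a * 2 ^ (b * (p - 2)) = - (2 ^ b) * 2 ^ (b * (p - 2))] (mod int p)"
    by (rule cong_scalar_right[OF ab])
  also have "[- (2 ^ b) * 2 ^ (b * (p - 2)) = - 1] (mod int p)"
    using inverse by (metis cong_minus_minus_iff mult_minus_left)
  finally have "[- 1 = 2 ^ (a + b * (p - 2))] (mod int p)"
    by (simp add: power_add cong_sym)
  then show False using no_power by blast
qed

text \<open>The first condition says that \<open>P\<close> is a predicate on residues modulo \<open>p\<close>. Its value at
  \<open>0\<close> is left open, since \<open>0\<close> is its own negative and never a difference of distinct residues.\<close>

definition doubling_orientation :: "nat \<Rightarrow> (int \<Rightarrow> bool) \<Rightarrow> bool" where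
  "doubling_orientation p P \<longleftrightarrow>
     (\<forall>s t. [s = t] (mod int p) \<longrightarrow> P s = P t) \<and>
     (\<forall>t. P (2 * t) = P t) \<and>
     (\<forall>t. \<not> int p dvd t \<longrightarrow> P (- t) = (\<not> P t))"

text \<open>Of the two disjoint orbits of \<open>t\<close> and \<open>- t\<close>, the one with the smaller minimum is
  selected.\<close>

lemma ex_doubling_orientation:
  assumes p: "prime p" "p > 3"
    and no_power: "\<not> (\<exists>r::nat. [-1 = 2 ^ r] (mod int p))"
  shows "\<exists>P. doubling_orientation p P"
proof -
  define P where "P t \<longleftrightarrow> Min (doubling_orbit p t) < Min (doubling_orbit p (- t))" for t
  have "P s = P t" if "[s = t] (mod int p)" for s t
    using doubling_orbit_cong[OF that] doubling_orbit_cong[of "- s" "- t" p] that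
    by (simp add: P_def cong_minus_minus_iff)
  moreover have "P (2 * t) = P t" for t
    using doubling_orbit_double[OF p, of t] doubling_orbit_double[OF p, of "- t"]
    by (simp add: P_def)
  moreover have "P (- t) = (\<not> P t)" if "\<not> int p dvd t" for t
  proof -
    have "p > 0" using p(2) by simp
    then have "Min (doubling_orbit p s) \<in> doubling_orbit p s" for s
      by (intro Min_in finite_doubling_orbit doubling_orbit_nonempty)
    then have "Min (doubling_orbit p t) \<noteq> Min (doubling_orbit p (- t))"
      using doubling_orbit_uminus_disjoint[OF p no_power that] by (metis disjoint_iff)
    then show ?thesis by (auto simp: P_def)
  qed
  ultimately show ?thesis unfolding doubling_orientation_def by blast
qed

text \<open>The second point at infinity uses the opposite choice.\<close>

lemma doubling_orientation_not:
  "doubling_orientation p P \<Longrightarrow> doubling_orientation p (\<lambda>t. \<not> P t)"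
  by (auto simp: doubling_orientation_def)

section \<open>The colouring by sums\<close>

text \<open>If \<open>F\<close> consists of one or two residues, this is the residue that replaces a point at infinity; in
  particular it is \<open>x\<close> when \<open>F = {x}\<close>.\<close>

definition substitute :: "(int \<Rightarrow> bool) \<Rightarrow> nat set \<Rightarrow> nat" where
  "substitute P F = (SOME x. x \<in> F \<and> (\<forall>y\<in>F. y \<noteq> x \<longrightarrow> P (int x - int y)))"

definition substituted_sum :: "nat \<Rightarrow> (int \<Rightarrow> bool) \<Rightarrow> nat set \<Rightarrow> nat" where
  "substituted_sum p P A = \<Sum>(A \<inter> {0..<p})
     + (if p \<in> A then substitute P (A \<inter> {0..<p}) else 0)
     + (if p + 1 \<in> A then substitute (\<lambda>t. \<not> P t) (A \<inter> {0..<p}) else 0)"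

definition choice_at :: "nat \<Rightarrow> (int \<Rightarrow> bool) \<Rightarrow> nat \<Rightarrow> int \<Rightarrow> bool" where
  "choice_at p P e = (if e = p then P else (\<lambda>t. \<not> P t))"

lemma doubling_orientation_choice_at:
  "doubling_orientation p P \<Longrightarrow> doubling_orientation p (choice_at p P e)"
  by (simp add: choice_at_def doubling_orientation_not)

lemma substitute_singleton: "substitute P {x} = x"
  unfolding substitute_def by (rule some_equality) auto

lemma not_dvd_diff_residues:
  assumes "x < p" "y < p" "x \<noteq> y"
  shows "\<not> int p dvd int x - int y"
proof
  assume "int p dvd int x - int y"
  then have "[x = y] (mod p)" by (simp add: cong_iff_dvd_diff flip: cong_int_iff)
  then show False using assms by (simp add: cong_def)
qed

lemma doubling_orientation_swap:
  assumes "doubling_orientation p P" "x < p" "y < p" "x \<noteq> y"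
  shows "P (int y - int x) \<longleftrightarrow> \<not> P (int x - int y)"
proof -
  have "P (- (int x - int y)) = (\<not> P (int x - int y))"
    using assms(1) not_dvd_diff_residues[OF assms(2-4)] unfolding doubling_orientation_def by blast
  then show ?thesis by simp
qed

lemma substitute_pair:
  assumes "doubling_orientation p P" "x < p" "y < p" "x \<noteq> y"
  shows "substitute P {x, y} = (if P (int x - int y) then x else y)"
  unfolding substitute_def
  using doubling_orientation_swap[OF assms] assms(4) by (intro some_equality) (auto split: if_splits)

lemma substituted_sum_residues:
  assumes "a < p" "b < p" "c < p" "a \<noteq> b" "a \<noteq> c" "b \<noteq> c"
  shows "substituted_sum p P {a, b, c} = a + b + c"
proof -
  have "{a, b, c} \<inter> {0..<p} = {a, b, c}" using assms by auto
  then show ?thesis using assms by (auto simp: substituted_sum_def)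
qed

lemma substituted_sum_one_infinity:
  assumes "doubling_orientation p P" "a < p" "b < p" "a \<noteq> b" "e \<in> {p, p + 1}"
  shows "substituted_sum p P {a, b, e} =
    a + b + (if choice_at p P e (int a - int b) then a else b)"
proof -
  have F: "{a, b, e} \<inter> {0..<p} = {a, b}" using assms by auto
  show ?thesis
  proof (cases "e = p")
    case True
    then show ?thesis unfolding substituted_sum_def F
      using assms substitute_pair[OF assms(1-4)] by (simp add: choice_at_def)
  next
    case False
    then show ?thesis unfolding substituted_sum_def F
      using assms substitute_pair[OF doubling_orientation_not[OF assms(1)] assms(2-4)]
      by (simp add: choice_at_def)
  qed
qed

lemma substituted_sum_two_infinities:
  assumes "a < p"
  shows "substituted_sum p P {a, p, p + 1} = 3 * a"
proof -
  have "{a, p, p + 1} \<inter> {0..<p} = {a}" using assms by auto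
  then show ?thesis by (simp add: substituted_sum_def substitute_singleton)
qed

section \<open>Triples sharing two points have different colours\<close>

text \<open>For \<open>k = 1, 2, 3\<close>, this excludes every coincidence of colours that does not involve the
  predicate \<open>P\<close>; \<open>p > 3\<close> is used here.\<close>

lemma residue_cancel:
  fixes x y c k :: nat
  assumes "[m = m'] (mod p)" "m = c + k * x" "m' = c + k * y"
    and "prime p" "0 < k" "k < p" "x < p" "y < p"
  shows "x = y"
proof -
  have "[k * x = k * y] (mod p)" using assms(1-3) by (simp add: cong_add_lcancel_nat)
  moreover have "\<not> p dvd k" using assms(5,6) by (auto dest: dvd_imp_le)
  then have "coprime k p"
    using prime_imp_coprime[OF assms(4)] by (simp add: coprime_commute)
  ultimately have "[x = y] (mod p)" by (simp add: cong_mult_lcancel_nat)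
  then show ?thesis using assms(7,8) by (simp add: cong_def)
qed

text \<open>The configuration for which invariance under doubling is required: here
  \<open>x - a = 2 (y - a)\<close>, so the rule prefers \<open>a\<close> to \<open>x\<close> exactly when it prefers \<open>a\<close> to \<open>y\<close>.\<close>

lemma choice_at_midpoint:
  assumes P: "doubling_orientation p P" and "[a + x = 2 * y] (mod p)"
  shows "P (int a - int x) = P (int a - int y)"
proof -
  have "[int a + int x = 2 * int y] (mod int p)"
    using assms(2) by (metis cong_int_iff of_nat_add of_nat_mult of_nat_numeral)
  then have "[int a - int x = 2 * (int a - int y)] (mod int p)"
    using cong_diff[OF cong_refl[of "2 * int a"]] by fastforce
  then show ?thesis using P unfolding doubling_orientation_def by metis
qed

text \<open>If \<open>a\<close> and \<open>b\<close> are residues, the third point contributes itself, or \<open>a\<close>, or \<open>b\<close>,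
  and the two points at infinity contribute different ones of \<open>a\<close> and \<open>b\<close>.
  So distinct third points contribute distinct residues.\<close>

lemma substituted_sum_distinct_shared_residues:
  assumes p: "prime p" "p > 3" and P: "doubling_orientation p P"
    and ab: "a < p" "b < p" "a \<noteq> b"
    and x: "x < p + 2" "x \<notin> {a, b}" and y: "y < p + 2" "y \<notin> {a, b}" and "x \<noteq> y"
  shows "\<not> [substituted_sum p P {a, b, x} = substituted_sum p P {a, b, y}] (mod p)"
proof
  assume eq: "[substituted_sum p P {a, b, x} = substituted_sum p P {a, b, y}] (mod p)"
  \<comment> \<open>The residue that the third point of the triple counts as.\<close>
  define w where "w z = (if z < p then z else if choice_at p P z (int a - int b) then a else b)"
    for z
  have sum: "substituted_sum p P {a, b, z} = a + b + w z" if "z < p + 2" "z \<notin> {a, b}" for z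
  proof (cases "z < p")
    case True
    then show ?thesis using that ab by (simp add: w_def substituted_sum_residues)
  next
    case False
    then have "z \<in> {p, p + 1}" using that by auto
    then show ?thesis using False substituted_sum_one_infinity[OF P ab] by (simp add: w_def)
  qed
  have less: "w z < p" for z using ab by (simp add: w_def)
  have w_eq: "w x = w y"
    using residue_cancel[OF eq, of "a + b" 1 "w x" "w y"] sum[OF x] sum[OF y] p less by simp
  have infinities: "z = p \<or> z = p + 1" if "z < p + 2" "\<not> z < p" for z using that by auto
  show False
    using w_eq x y \<open>x \<noteq> y\<close> ab infinities[OF x(1)] infinities[OF y(1)]
    by (auto simp: w_def choice_at_def split: if_splits)
qed

text \<open>With \<open>a\<close> and a point at infinity in common, the colour is \<open>2a + x\<close> or \<open>a + 2x\<close> for a third point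
  \<open>x\<close> that is a residue, and \<open>3a\<close>, the value of both expressions at \<open>x = a\<close>, for the other point
  at infinity. Expressions of the same kind are separated by cancellation, and
  \<open>choice_at_midpoint\<close> separates \<open>2a + x\<close> from \<open>a + 2y\<close>.\<close>

lemma substituted_sum_distinct_shared_mixed:
  assumes p: "prime p" "p > 3" and P: "doubling_orientation p P"
    and a: "a < p" and e: "e \<in> {p, p + 1}"
    and x: "x < p + 2" "x \<notin> {a, e}" and y: "y < p + 2" "y \<notin> {a, e}" and "x \<noteq> y"
  shows "\<not> [substituted_sum p P {a, e, x} = substituted_sum p P {a, e, y}] (mod p)"
proof
  assume eq: "[substituted_sum p P {a, e, x} = substituted_sum p P {a, e, y}] (mod p)"
  let ?Q = "choice_at p P e"
  have Q: "doubling_orientation p ?Q" using P by (rule doubling_orientation_choice_at)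
  have one: "substituted_sum p P {a, e, z} = a + z + (if ?Q (int a - int z) then a else z)"
    if "z < p" "z \<noteq> a" for z
    using substituted_sum_one_infinity[OF P a that(1) that(2)[symmetric] e]
    by (simp add: insert_commute)
  have two: "substituted_sum p P {a, e, z} = 3 * a" if "\<not> z < p" "z < p + 2" "z \<noteq> e" for z
  proof -
    have "{a, e, z} = {a, p, p + 1}" using that e by auto
    then show ?thesis using substituted_sum_two_infinities[OF a] by simp
  qed
  have mixed: False
    if z: "z < p" "z \<noteq> a"
      and cong: "[a + z + (if ?Q (int a - int z) then a else z) = 3 * a] (mod p)" for z
  proof (cases "?Q (int a - int z)")
    case True
    then show ?thesis using residue_cancel[OF cong, of "2 * a" 1 z a] p z a by simp
  next
    case False
    then show ?thesis using residue_cancel[OF cong, of a 2 z a] p z a by simp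
  qed
  have clash: False
    if z: "z < p" "z' < p" "z' \<noteq> a" and "?Q (int a - int z)" "\<not> ?Q (int a - int z')"
      and cong: "[a + z + a = a + z' + z'] (mod p)" for z z'
  proof -
    have "a + z + a = a + (a + z)" "a + z' + z' = a + 2 * z'" by simp_all
    then have "[a + (a + z) = a + 2 * z'] (mod p)" using cong by (simp only:)
    then have "[a + z = 2 * z'] (mod p)" by (simp only: cong_add_lcancel_nat)
    then show False using choice_at_midpoint[OF Q] that by blast
  qed
  show False
  proof (cases "x < p")
    case xp: True
    show False
    proof (cases "y < p")
      case yp: True
      have eq': "[a + x + (if ?Q (int a - int x) then a else x)
                = a + y + (if ?Q (int a - int y) then a else y)] (mod p)"
        using eq one[OF xp] one[OF yp] x y by simp
      consider (first) "?Q (int a - int x)" "?Q (int a - int y)"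
        | (second) "\<not> ?Q (int a - int x)" "\<not> ?Q (int a - int y)"
        | (xy) "?Q (int a - int x)" "\<not> ?Q (int a - int y)"
        | (yx) "\<not> ?Q (int a - int x)" "?Q (int a - int y)"
        by blast
      then show False
      proof cases
        case first
        then show False
          using residue_cancel[OF eq', of "2 * a" 1 x y] p xp yp \<open>x \<noteq> y\<close> by simp
      next
        case second
        then show False
          using residue_cancel[OF eq', of a 2 x y] p xp yp \<open>x \<noteq> y\<close> by simp
      next
        case xy
        then show False using clash[OF xp yp] eq' y by simp
      next
        case yx
        then show False using clash[OF yp xp] cong_sym[OF eq'] x by simp
      qed
    next
      case False
      then show False using mixed[OF xp] eq one[OF xp] two[OF False] x y by simp
    qed
  next
    case xp: False
    then have yp: "y < p" using x y e \<open>x \<noteq> y\<close> by auto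
    then show False using mixed[OF yp] cong_sym[OF eq] one[OF yp] two[OF xp] x y by simp
  qed
qed

lemma substituted_sum_distinct_shared_infinities:
  assumes p: "prime p" "p > 3"
    and x: "x < p" and y: "y < p" and "x \<noteq> y"
  shows "\<not> [substituted_sum p P {p, p + 1, x} = substituted_sum p P {p, p + 1, y}] (mod p)"
proof -
  have "substituted_sum p P {p, p + 1, z} = 3 * z" if "z < p" for z
    using substituted_sum_two_infinities[OF that, of P] by (simp add: insert_commute)
  then show ?thesis using residue_cancel[of _ _ p 0 3 x y] assms by auto
qed

lemma substituted_sum_distinct:
  assumes p: "prime p" "p > 3" and P: "doubling_orientation p P"
    and ab: "a < p + 2" "b < p + 2" "a \<noteq> b"
    and x: "x < p + 2" "x \<notin> {a, b}" and y: "y < p + 2" "y \<notin> {a, b}" and "x \<noteq> y"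
  shows "\<not> [substituted_sum p P {a, b, x} = substituted_sum p P {a, b, y}] (mod p)"
proof -
  consider "a < p" "b < p" | "a < p" "b \<in> {p, p + 1}" | "b < p" "a \<in> {p, p + 1}"
    | "a = p" "b = p + 1" | "b = p" "a = p + 1"
    using ab by force
  then show ?thesis
  proof cases
    case 1
    then show ?thesis using substituted_sum_distinct_shared_residues assms by blast
  next
    case 2
    then show ?thesis using substituted_sum_distinct_shared_mixed assms by blast
  next
    case 3
    then show ?thesis
      using substituted_sum_distinct_shared_mixed[OF p P, of b a x y] x y \<open>x \<noteq> y\<close>
      by (auto simp: insert_commute)
  next
    case 4
    then have "x < p" "y < p" using x y by auto
    then show ?thesis
      using substituted_sum_distinct_shared_infinities[OF p] 4 \<open>x \<noteq> y\<close> by blast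
  next
    case 5
    then have "x < p" "y < p" using x y by auto
    then show ?thesis
      using substituted_sum_distinct_shared_infinities[OF p, of x y P] 5 \<open>x \<noteq> y\<close>
      by (simp add: insert_commute)
  qed
qed

section \<open>The chromatic number\<close>

lemma triples_sharing_pair:
  assumes "card u = 3" "card v = 3" "card (u \<inter> v) = 2"
  obtains a b x y where "u = {a, b, x}" "v = {a, b, y}" "a \<noteq> b"
    "x \<notin> {a, b}" "y \<notin> {a, b}" "x \<noteq> y"
proof -
  have fin: "finite u" "finite v"
    using assms by (metis card.infinite zero_neq_numeral)+
  obtain a b where ab: "u \<inter> v = {a, b}" "a \<noteq> b"
    using assms(3) by (auto simp: card_2_iff)
  have "card (u - u \<inter> v) = 1" "card (v - u \<inter> v) = 1"
    using assms fin by (simp_all add: card_Diff_subset)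
  then obtain x y where xy: "u - u \<inter> v = {x}" "v - u \<inter> v = {y}"
    by (auto simp: card_1_singleton_iff)
  show thesis
  proof
    show "u = {a, b, x}" "v = {a, b, y}" using ab xy by blast+
    show "a \<noteq> b" "x \<notin> {a, b}" "y \<notin> {a, b}" "x \<noteq> y" using ab xy by blast+
  qed
qed

lemma proper_coloring_substituted_sum:
  assumes p: "prime p" "p > 3" and P: "doubling_orientation p P" and n: "n \<le> p + 2"
  shows "proper_coloring (intersection_graph n 3 2) p (\<lambda>A. substituted_sum p P A mod p)"
proof -
  have distinct: "substituted_sum p P u mod p \<noteq> substituted_sum p P v mod p"
    if uv: "u \<in> subsets_of_size n 3" "v \<in> subsets_of_size n 3" "card (u \<inter> v) = 2" for u v
  proof -
    have "card u = 3" "card v = 3" using uv by (simp_all add: subsets_of_size_def)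
    then obtain a b x y where *: "u = {a, b, x}" "v = {a, b, y}" "a \<noteq> b"
        "x \<notin> {a, b}" "y \<notin> {a, b}" "x \<noteq> y"
      using triples_sharing_pair uv(3) by metis
    have "a < p + 2" "b < p + 2" "x < p + 2" "y < p + 2"
      using uv * n by (auto simp: subsets_of_size_def)
    then show ?thesis
      using substituted_sum_distinct[OF p P] * by (simp add: cong_def)
  qed
  have "substituted_sum p P u mod p \<noteq> substituted_sum p P v mod p"
    if "{u, v} \<in> edges (intersection_graph n 3 2)" for u v
  proof -
    have "u \<in> subsets_of_size n 3 \<and> v \<in> subsets_of_size n 3 \<and> card (u \<inter> v) = 2"
      using that unfolding edges_def intersection_graph_def
      by (auto simp: doubleton_eq_iff Int_commute)
    then show ?thesis using distinct by blast
  qed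
  then show ?thesis using p by (simp add: proper_coloring_def)
qed

lemma chromatic_number_triples_le:
  assumes "prime p" "p > 3" "\<not> (\<exists>r::nat. [-1 = 2 ^ r] (mod int p))" "n \<le> p + 2"
  shows "chromatic_number (intersection_graph n 3 2) \<le> p"
  using ex_doubling_orientation[OF assms(1-3)] proper_coloring_substituted_sum[OF assms(1,2) _ assms(4)]
  unfolding chromatic_number_def by (blast intro: Least_le)

theorem theorem1:
  fixes p :: nat
  assumes "prime p" and "p > 3"
    and "\<not> (\<exists>r::nat. [-1 = 2 ^ r] (mod int p))"
  shows "(\<forall>n. n = p + 2 \<longrightarrow> chromatic_number (intersection_graph n 3 2) \<le> n - 2) \<and>
         (\<forall>n. n = p + 1 \<longrightarrow> chromatic_number (intersection_graph n 3 2) \<le> n - 1)"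
  using chromatic_number_triples_le[OF assms] by simp

end
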